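(* Let $X$ be a closure space and let $\{A,B\}$ be an interior cover of $X$. Give $A$, $B$ and $A\cap B$ their subspace closure operations. Then there is a long exact sequence \[\cdots\to H_n(A\cap B)\to H_n(A)\oplus H_n(B)\to H_n(X)\to H_{n-1}(A\cap B)\to \cdots\]
   Context: A (Čech) closure space is a pair $(X,c)$ of a set $X$ and a function $c:2^X\to 2^X$ with $c(\varnothing)=\varnothing$, $A\subset c(A)$, and $c(A\cup B)=c(A)\cup c(B)$ for all $A,B\subset X$. Topological spaces are the closure spaces with $c(c(A))=c(A)$ for all $A$, where $c$ is the topological closure. A map $f:(X,c)\to(Y,d)$ is continuous if $f(c(A))\subset d(f(A))$ for all $A\subset X$. A subset $A\subset X$ carries the subspace closure $c_A(B)=A\cap c(B)$ for $B\subset A$. The interior operator is $i(A)=X\setminus c(X\setminus A)$. A family $\mathcal{U}$ of subsets is an interior cover of $X$ if $X=\bigcup_{U\in\mathcal{U}} i(U)$. Singular homology: let $|\Delta^n|=\{(t_0,\dots,t_n)\in\mathbb{R}^{n+1} : \sum_i t_i=1,\ t_i\ge 0\}=[e_0,\dots,e_n]$ with the Euclidean topology. $C_n(X)$ is the free abelian group on continuous maps $\sigma:|\Delta^n|\to X$ (and $C_n(X)=0$ for $n<0$), $\partial_n(\sigma)=\sum_{i=0}^n(-1)^i\sigma|_{[e_0,\dots,\hat e_i,\dots,e_n]}$, and $H_n(X)=\ker\partial_n/\operatorname{im}\partial_{n+1}$. *)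

theory Defs
  imports "HOL-Homology.Homology"
begin

text \<open>
  A closure space is given by a carrier set together with a function on sets, of which only the
  values on subsets of the carrier matter.
\<close>

definition closure_space :: "'a set \<Rightarrow> ('a set \<Rightarrow> 'a set) \<Rightarrow> bool" where
  "closure_space X c \<longleftrightarrow>
     (\<forall>S. S \<subseteq> X \<longrightarrow> c S \<subseteq> X) \<and>
     c {} = {} \<and>
     (\<forall>S. S \<subseteq> X \<longrightarrow> S \<subseteq> c S) \<and>
     (\<forall>S T. S \<subseteq> X \<longrightarrow> T \<subseteq> X \<longrightarrow> c (S \<union> T) = c S \<union> c T)"

definition closure_continuous ::
  "'a set \<Rightarrow> ('a set \<Rightarrow> 'a set) \<Rightarrow> 'b set \<Rightarrow> ('b set \<Rightarrow> 'b set) \<Rightarrow> ('a \<Rightarrow> 'b) \<Rightarrow> bool" where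
  "closure_continuous X c Y d f \<longleftrightarrow> f \<in> X \<rightarrow> Y \<and> (\<forall>S. S \<subseteq> X \<longrightarrow> f ` c S \<subseteq> d (f ` S))"

definition subspace_closure :: "'a set \<Rightarrow> ('a set \<Rightarrow> 'a set) \<Rightarrow> 'a set \<Rightarrow> 'a set" where
  "subspace_closure A c = (\<lambda>S. A \<inter> c S)"

definition interior_op :: "'a set \<Rightarrow> ('a set \<Rightarrow> 'a set) \<Rightarrow> 'a set \<Rightarrow> 'a set" where
  "interior_op X c S = X - c (X - S)"

definition interior_cover :: "'a set \<Rightarrow> ('a set \<Rightarrow> 'a set) \<Rightarrow> 'a set set \<Rightarrow> bool" where
  "interior_cover X c \<U> \<longleftrightarrow> (\<forall>U\<in>\<U>. U \<subseteq> X) \<and> X = (\<Union>U\<in>\<U>. interior_op X c U)"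

text \<open>
  Following HOL-Homology, points of the standard \<open>n\<close>-simplex are functions \<open>nat \<Rightarrow> real\<close> vanishing
  beyond \<open>n\<close>, so the product topology induces the Euclidean one; and a map defined on the
  simplex is \<open>undefined\<close> off it, so that maps agreeing on the simplex are equal.
\<close>

definition closure_simplex ::
  "nat \<Rightarrow> 'a set \<Rightarrow> ('a set \<Rightarrow> 'a set) \<Rightarrow> ((nat \<Rightarrow> real) \<Rightarrow> 'a) \<Rightarrow> bool" where
  "closure_simplex n X c \<sigma> \<longleftrightarrow>
     closure_continuous (standard_simplex n)
       ((closure_of) (subtopology (powertop_real UNIV) (standard_simplex n))) X c \<sigma> \<and>
     \<sigma> \<in> extensional (standard_simplex n)"

text \<open>
  Degrees are integers: for \<open>n < 0\<close> there are no generators and the chain group is trivial.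
\<close>

definition closure_chain_group :: "int \<Rightarrow> 'a set \<Rightarrow> ('a set \<Rightarrow> 'a set) \<Rightarrow> 'a chain monoid" where
  "closure_chain_group n X c = free_Abelian_group {\<sigma>. 0 \<le> n \<and> closure_simplex (nat n) X c \<sigma>}"

text \<open>
  The operator \<open>chain_boundary\<close> of HOL-Homology is the alternating sum of faces in positive degrees
  and zero in degree \<open>0\<close>; hence \<open>chain_boundary (nat n)\<close> is the zero map for every \<open>n \<le> 0\<close>.
\<close>

definition closure_cycle_group :: "int \<Rightarrow> 'a set \<Rightarrow> ('a set \<Rightarrow> 'a set) \<Rightarrow> 'a chain monoid" where
  "closure_cycle_group n X c =
     subgroup_generated (closure_chain_group n X c)
       (kernel (closure_chain_group n X c) (closure_chain_group (n - 1) X c)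
         (chain_boundary (nat n)))"

definition closure_boundaries :: "int \<Rightarrow> 'a set \<Rightarrow> ('a set \<Rightarrow> 'a set) \<Rightarrow> 'a chain set" where
  "closure_boundaries n X c =
     chain_boundary (nat (n + 1)) ` carrier (closure_chain_group (n + 1) X c)"

definition closure_homology :: "int \<Rightarrow> 'a set \<Rightarrow> ('a set \<Rightarrow> 'a set) \<Rightarrow> 'a chain set monoid" where
  "closure_homology n X c = closure_cycle_group n X c Mod closure_boundaries n X c"

text \<open>
  The map induced on homology by \<open>f\<close>, with target \<open>(Y, d)\<close>. A homology class \<open>K\<close> is a coset of
  cycles; if \<open>f\<close> is continuous, all elements of \<open>K\<close> yield the same class, which \<open>the_elem\<close> extracts.
\<close>

definition closure_hom_induced ::
  "int \<Rightarrow> 'b set \<Rightarrow> ('b set \<Rightarrow> 'b set) \<Rightarrow> ('a \<Rightarrow> 'b) \<Rightarrow> 'a chain set \<Rightarrow> 'b chain set" where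
  "closure_hom_induced n Y d f K =
     the_elem ((\<lambda>z. closure_boundaries n Y d #>\<^bsub>closure_cycle_group n Y d\<^esub> chain_map (nat n) f z) ` K)"

text \<open>
  Exactness at \<open>H\<close>, for possibly different types (the library's \<open>exact_seq\<close> requires a single type,
  which rules out direct products \<open>G \<times>\<times> H\<close>).
\<close>

definition exact_at ::
  "('a, 'm) monoid_scheme \<Rightarrow> ('a \<Rightarrow> 'b) \<Rightarrow> ('b, 'n) monoid_scheme \<Rightarrow> ('b \<Rightarrow> 'c) \<Rightarrow>
   ('c, 'k) monoid_scheme \<Rightarrow> bool" where
  "exact_at G f H g K \<longleftrightarrow> group_hom G H f \<and> group_hom H K g \<and> f ` carrier G = kernel H K g"

text \<open>
  The two maps of the Mayer--Vietoris sequence induced by inclusions, with the sign placed on the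
  first one: \<open>x \<mapsto> (x, -x)\<close> and \<open>(a, b) \<mapsto> a + b\<close>.
\<close>

definition mv_diff ::
  "int \<Rightarrow> 'a set \<Rightarrow> 'a set \<Rightarrow> ('a set \<Rightarrow> 'a set) \<Rightarrow> 'a chain set \<Rightarrow> 'a chain set \<times> 'a chain set" where
  "mv_diff n A B c = (\<lambda>x.
     (closure_hom_induced n A (subspace_closure A c) id x,
      inv\<^bsub>closure_homology n B (subspace_closure B c)\<^esub>
        closure_hom_induced n B (subspace_closure B c) id x))"

definition mv_sum ::
  "int \<Rightarrow> 'a set \<Rightarrow> ('a set \<Rightarrow> 'a set) \<Rightarrow> 'a chain set \<times> 'a chain set \<Rightarrow> 'a chain set" where
  "mv_sum n X c = (\<lambda>(a, b).
     closure_hom_induced n X c id a \<otimes>\<^bsub>closure_homology n X c\<^esub> closure_hom_induced n X c id b)"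

end

theory Submission
  imports Defs
begin

text \<open>
  A closure-continuous simplex \<open>f : \<Delta>\<^sup>q \<rightarrow> X\<close>, precomposed with a continuous map \<open>\<Delta>\<^sup>p \<rightarrow> \<Delta>\<^sup>q\<close>,
  is closure-continuous again. Hence every operation on chains that sends a simplex \<open>f\<close> to the
  image under \<open>f\<close> of one fixed chain of the standard simplex maps \<open>C(Y)\<close> to itself for every closure
  space \<open>Y\<close> (\<open>closure_chain_natural_operation\<close>). The boundary, barycentric subdivision \<open>sd\<close> and the
  homotopy between \<open>sd\<close> and the identity are of this kind. The identities that relate them say
  nothing about continuity of \<open>f\<close>, so they follow from the theory of topological spaces, applied to
  the indiscrete topology, for which every map into \<open>X\<close> is continuous.

  Apart from this, the closure operation enters at one point. If \<open>f\<close> is closure-continuous, then the preimage of the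
  interior \<open>i(U)\<close> need not be open, but it lies in the topological interior of the preimage of \<open>U\<close>
  (\<open>interior_of_preimage\<close>). So an interior cover \<open>{A, B}\<close> yields an open cover of the standard
  simplex, and by compactness some iterated subdivision of every chain of \<open>X\<close> lies in \<open>C(A) + C(B)\<close>.
  Since subdivision is homotopic to the identity within each of \<open>C(A)\<close>, \<open>C(B)\<close> and \<open>C(X)\<close>, two facts
  follow: every cycle of \<open>X\<close> is homologous to a sum \<open>a + b\<close> (\<open>cycle_homologous_to_sum\<close>), and a sum
  \<open>a + b\<close> that bounds in \<open>X\<close> bounds a chain in \<open>C(A) + C(B)\<close> (\<open>boundary_of_sum\<close>). In other words,
  \<open>C(A) + C(B) \<rightarrow> C(X)\<close> induces an isomorphism on homology.

  Because \<open>C(A) \<inter> C(B) = C(A \<inter> B)\<close>, the sequence \<open>0 \<rightarrow> C(A \<inter> B) \<rightarrow> C(A) \<oplus> C(B) \<rightarrow> C(A) + C(B) \<rightarrow> 0\<close>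
  is exact, and the theorem is its long exact homology sequence. The connecting map sends the
  class of \<open>a + b\<close> to the class of \<open>\<partial>a = - \<partial>b\<close>.
\<close>

section \<open>Singular chains of a closure space\<close>

abbreviation simplex_space :: "nat \<Rightarrow> (nat \<Rightarrow> real) topology" where
  "simplex_space p \<equiv> subtopology (powertop_real UNIV) (standard_simplex p)"

abbreviation identity_simplex :: "nat \<Rightarrow> (nat \<Rightarrow> real) chain" where
  "identity_simplex p \<equiv> frag_of (restrict id (standard_simplex p))"

definition closure_chain :: "nat \<Rightarrow> 'a set \<Rightarrow> ('a set \<Rightarrow> 'a set) \<Rightarrow> 'a chain \<Rightarrow> bool" where
  "closure_chain p X c z \<longleftrightarrow> Poly_Mapping.keys z \<subseteq> Collect (closure_simplex p X c)"

lemma closure_chain_0 [simp]: "closure_chain p X c 0"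
  by (simp add: closure_chain_def)

lemma closure_chain_of [simp]: "closure_chain p X c (frag_of f) \<longleftrightarrow> closure_simplex p X c f"
  by (simp add: closure_chain_def)

lemma closure_chain_cmul: "closure_chain p X c z \<Longrightarrow> closure_chain p X c (frag_cmul k z)"
  unfolding closure_chain_def using keys_cmul by blast

lemma closure_chain_minus [simp]: "closure_chain p X c (- z) \<longleftrightarrow> closure_chain p X c z"
  by (simp add: closure_chain_def)

lemma closure_chain_add:
  "closure_chain p X c z \<Longrightarrow> closure_chain p X c w \<Longrightarrow> closure_chain p X c (z + w)"
  unfolding closure_chain_def using keys_add [of z w] by blast

lemma closure_chain_diff:
  "closure_chain p X c z \<Longrightarrow> closure_chain p X c w \<Longrightarrow> closure_chain p X c (z - w)"
  unfolding closure_chain_def using keys_diff [of z w] by blast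

lemma closure_chain_sum:
  "(\<And>i. i \<in> I \<Longrightarrow> closure_chain p X c (f i)) \<Longrightarrow> closure_chain p X c (sum f I)"
  by (induction I rule: infinite_finite_induct) (auto intro: closure_chain_add)

lemma closure_chain_extend:
  assumes "\<And>f. f \<in> Poly_Mapping.keys z \<Longrightarrow> closure_chain q X c (g f)"
  shows "closure_chain q X c (frag_extend g z)"
  unfolding frag_extend_def using assms by (intro closure_chain_sum closure_chain_cmul) auto

lemma closure_simplex_in_space: "closure_simplex p X c f \<Longrightarrow> f \<in> standard_simplex p \<rightarrow> X"
  by (simp add: closure_simplex_def closure_continuous_def)

lemma closure_simplex_image_closure:
  "closure_simplex p X c f \<Longrightarrow> S \<subseteq> standard_simplex p \<Longrightarrow>
   f ` (simplex_space p closure_of S) \<subseteq> c (f ` S)"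
  by (simp add: closure_simplex_def closure_continuous_def)

text \<open>
  Maps into a subspace are maps into the whole space with image in the subspace, as for topological
  spaces; therefore the chain groups of \<open>A\<close>, \<open>B\<close> and \<open>A \<inter> B\<close> are subgroups of that of \<open>X\<close>.
\<close>

lemma closure_simplex_subspace_iff:
  assumes "A \<subseteq> X"
  shows "closure_simplex p A (subspace_closure A c) f \<longleftrightarrow>
         closure_simplex p X c f \<and> f ` standard_simplex p \<subseteq> A"
proof -
  have "simplex_space p closure_of S \<subseteq> standard_simplex p" for S
    using closure_of_subset_topspace [of "simplex_space p"] by simp
  then have *: "f ` (simplex_space p closure_of S) \<subseteq> A" if "f ` standard_simplex p \<subseteq> A" for S
    using that by blast
  show ?thesis
    using assms *
    unfolding closure_simplex_def closure_continuous_def subspace_closure_def Pi_def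
    by (auto simp: image_subset_iff)
qed

lemma closure_chain_subspace_iff:
  assumes "A \<subseteq> X"
  shows "closure_chain p A (subspace_closure A c) z \<longleftrightarrow>
         closure_chain p X c z \<and> (\<forall>f \<in> Poly_Mapping.keys z. f ` standard_simplex p \<subseteq> A)"
  using closure_simplex_subspace_iff [OF assms] unfolding closure_chain_def by blast

lemma closure_simplex_simplex_map:
  assumes f: "closure_simplex q X c f" and g: "singular_simplex p (simplex_space q) g"
  shows "closure_simplex p X c (simplex_map p f g)"
proof -
  have gcont: "continuous_map (simplex_space p) (simplex_space q) g"
    using g by (simp add: singular_simplex_def)
  then have gq: "g \<in> standard_simplex p \<rightarrow> standard_simplex q"
    by (metis continuous_map_funspace topspace_standard_simplex)
  have "simplex_map p f g ` (simplex_space p closure_of S) \<subseteq> c (simplex_map p f g ` S)"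
    if S: "S \<subseteq> standard_simplex p" for S
  proof -
    have "simplex_space p closure_of S \<subseteq> standard_simplex p"
      using closure_of_subset_topspace [of "simplex_space p"] by simp
    then have "simplex_map p f g ` (simplex_space p closure_of S) = f ` g ` (simplex_space p closure_of S)"
      unfolding simplex_map_def image_image by (intro image_cong) auto
    also have "\<dots> \<subseteq> f ` (simplex_space q closure_of (g ` S))"
      using continuous_map_image_closure_subset [OF gcont] by (intro image_mono) auto
    also have "\<dots> \<subseteq> c (f ` g ` S)"
    proof -
      have "g ` S \<subseteq> standard_simplex q"
        using S gq by blast
      then show ?thesis
        using closure_simplex_image_closure [OF f] by blast
    qed
    also have "f ` g ` S = simplex_map p f g ` S"
      using S unfolding simplex_map_def image_image by (intro image_cong) auto
    finally show ?thesis .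
  qed
  moreover have "simplex_map p f g \<in> standard_simplex p \<rightarrow> X"
    using closure_simplex_in_space [OF f] gq unfolding simplex_map_def by auto
  ultimately show ?thesis
    unfolding closure_simplex_def closure_continuous_def
    by (simp add: simplex_map_def)
qed

text \<open>
  The operation determined by its value \<open>u\<close> on the identity simplex. All operations on chains below are
  of this form, which reduces their compatibility with closure spaces to the case of one simplex.
\<close>

definition natural_operation :: "nat \<Rightarrow> (nat \<Rightarrow> real) chain \<Rightarrow> 'a chain \<Rightarrow> 'a chain" where
  "natural_operation q u = frag_extend (\<lambda>f. chain_map q f u)"

lemma natural_operation_0 [simp]: "natural_operation q u 0 = 0"
  by (simp add: natural_operation_def)

lemma natural_operation_of: "natural_operation q u (frag_of f) = chain_map q f u"
  by (simp add: natural_operation_def)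

lemma natural_operation_add:
  "natural_operation q u (z + w) = natural_operation q u z + natural_operation q u w"
  by (simp add: natural_operation_def frag_extend_add)

lemma natural_operation_diff:
  "natural_operation q u (z - w) = natural_operation q u z - natural_operation q u w"
  by (simp add: natural_operation_def frag_extend_diff)

text \<open>
  The image of \<open>u\<close> under a simplex \<open>f\<close> consists of composites of \<open>f\<close> with continuous maps between
  standard simplices, and \<open>closure_simplex_simplex_map\<close> applies to these.
\<close>

lemma closure_chain_natural_operation:
  assumes z: "closure_chain p X c z" and u: "singular_chain q (simplex_space p) u"
  shows "closure_chain q X c (natural_operation q u z)"
  unfolding natural_operation_def
proof (rule closure_chain_extend)
  fix f assume "f \<in> Poly_Mapping.keys z"
  then have "closure_simplex p X c f"
    using z by (auto simp: closure_chain_def)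
  then show "closure_chain q X c (chain_map q f u)"
    unfolding chain_map_def using u
    by (intro closure_chain_extend) (auto simp: singular_chain_def intro: closure_simplex_simplex_map)
qed

text \<open>
  The pullback of the one-point space. Every map is continuous for this topology, which makes the
  identities between operations on singular chains available for simplices of closure spaces.
\<close>

definition indiscrete_topology :: "'a topology" where
  "indiscrete_topology = pullback_topology UNIV (\<lambda>_. ()) (discrete_topology UNIV)"

lemma continuous_map_indiscrete_topology: "continuous_map T indiscrete_topology f"
  unfolding indiscrete_topology_def
  by (rule continuous_map_pullback') (auto simp: o_def)

lemma closure_chain_imp_singular_chain:
  "closure_chain p X c z \<Longrightarrow> singular_chain p indiscrete_topology z"
  unfolding closure_chain_def singular_chain_def closure_simplex_def singular_simplex_def
  using continuous_map_indiscrete_topology by blast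

lemma singular_chain_identity_simplex: "singular_chain p (simplex_space p) (identity_simplex p)"
  by (simp add: simplicial_imp_singular_chain)

text \<open>
  A simplex \<open>f\<close> is the image of the identity simplex under \<open>f\<close>, and the boundary commutes with
  induced maps.
\<close>

lemma chain_boundary_eq_natural_operation:
  assumes "singular_chain p T z"
  shows "chain_boundary p z =
         natural_operation (p - Suc 0) (chain_boundary p (identity_simplex p)) z"
  using assms unfolding singular_chain_def
proof (induction z rule: frag_induction)
  case (one f)
  then have "chain_map p f (identity_simplex p) = frag_of f"
    using singular_simplex_chain_map_id by auto
  then show ?case
    unfolding natural_operation_of
    by (metis chain_boundary_chain_map singular_chain_identity_simplex)
qed (auto simp: chain_boundary_diff natural_operation_diff)

lemma closure_chain_boundary:
  assumes "closure_chain p X c z"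
  shows "closure_chain (p - Suc 0) X c (chain_boundary p z)"
  using chain_boundary_eq_natural_operation [OF closure_chain_imp_singular_chain [OF assms]]
    closure_chain_natural_operation [OF assms
      singular_chain_boundary [OF singular_chain_identity_simplex]]
  by simp

section \<open>Barycentric subdivision\<close>

lemma singular_subdivision_eq_natural_operation:
  "singular_subdivision p = natural_operation p (simplicial_subdivision p (identity_simplex p))"
  unfolding singular_subdivision_def natural_operation_def by simp

lemma simplicial_chain_identity_simplex:
  "simplicial_chain p (standard_simplex p) (identity_simplex p)"
  by simp

lemma closure_chain_subdivision:
  assumes "closure_chain p X c z"
  shows "closure_chain p X c ((singular_subdivision p ^^ n) z)"
proof (induction n)
  case (Suc n)
  then show ?case
    by (simp add: singular_subdivision_eq_natural_operation closure_chain_natural_operation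
        simplicial_imp_singular_chain simplicial_chain_simplicial_subdivision)
qed (simp add: assms)

text \<open>
  The homotopy from barycentric subdivision to the identity. It is written as a natural operation, with
  the cone construction \<open>subd\<close> on the standard simplex, because only its naturality shows that it
  stays within the chains of a closure space.
\<close>

definition subdivision_homotopy :: "nat \<Rightarrow> 'a chain \<Rightarrow> 'a chain" where
  "subdivision_homotopy p = natural_operation (Suc p) (subd p (identity_simplex p))"

lemma closure_chain_subdivision_homotopy:
  assumes "closure_chain p X c z"
  shows "closure_chain (Suc p) X c (subdivision_homotopy p z)"
  unfolding subdivision_homotopy_def
  by (intro closure_chain_natural_operation [OF assms] simplicial_imp_singular_chain
      chain_homotopic_simplicial_subdivision2 simplicial_chain_identity_simplex)

text \<open>
  The restriction to the standard simplex that is built into \<open>simplex_map\<close> does not affect chains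
  of that simplex.
\<close>

lemma chain_map_simplex_map:
  assumes "singular_simplex p (simplex_space q) g" and "singular_chain r (simplex_space p) u"
  shows "chain_map r (simplex_map p f g) u = chain_map r f (chain_map r g u)"
proof -
  have "chain_map r (simplex_map p f g) u = chain_map r (f \<circ> g) u"
    using assms(2) by (rule chain_map_eq) (simp add: simplex_map_def)
  then show ?thesis
    by (simp add: chain_map_compose)
qed

text \<open>
  Naturality of the cone construction with respect to affine maps between standard simplices. It is
  what identifies the homotopy on the boundary of \<open>f\<close>, defined face by face, with the image under \<open>f\<close> of
  the homotopy on the boundary of the standard simplex.
\<close>

lemma subdivision_homotopy_chain_map:
  assumes "simplicial_chain q (standard_simplex p) d"
  shows "subdivision_homotopy q (chain_map q f d) = chain_map (Suc q) f (subd q d)"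
  using assms unfolding simplicial_chain_def
proof (induction d rule: frag_induction)
  case (one g)
  then have g: "simplicial_simplex q (standard_simplex p) g"
    by simp
  then have gs: "singular_simplex q (simplex_space p) g"
    by (rule simplicial_imp_singular_simplex)
  have "subdivision_homotopy q (chain_map q f (frag_of g))
        = chain_map (Suc q) (simplex_map q f g) (subd q (identity_simplex q))"
    by (simp add: subdivision_homotopy_def natural_operation_of)
  also have "\<dots> = chain_map (Suc q) f (chain_map (Suc q) g (subd q (identity_simplex q)))"
    by (intro chain_map_simplex_map [OF gs] simplicial_imp_singular_chain
        chain_homotopic_simplicial_subdivision2 simplicial_chain_identity_simplex)
  also have "chain_map (Suc q) g (subd q (identity_simplex q)) = subd q (chain_map q g (identity_simplex q))"
    using chain_homotopic_simplicial_subdivision1 [OF simplicial_chain_identity_simplex g] .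
  also have "chain_map q g (identity_simplex q) = frag_of g"
    using singular_simplex_chain_map_id [OF gs] .
  finally show ?case .
qed (auto simp: chain_map_diff subdivision_homotopy_def natural_operation_diff)

text \<open>
  For a simplex \<open>f\<close>, both sides are images under \<open>f\<close> of chains of the standard simplex, where the
  identity holds by construction of the cones.
\<close>

lemma chain_homotopy_subdivision:
  assumes "singular_chain p T z"
  shows "chain_boundary (Suc p) (subdivision_homotopy p z) +
         subdivision_homotopy (p - Suc 0) (chain_boundary p z) = singular_subdivision p z - z"
  using assms unfolding singular_chain_def
proof (induction z rule: frag_induction)
  case (one f)
  let ?\<iota> = "identity_simplex p"
  have "chain_map p f ?\<iota> = frag_of f"
    using one singular_simplex_chain_map_id by auto
  then have f: "simplex_map p f (restrict id (standard_simplex p)) = f"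
    by (simp add: frag_of_eq del: simplex_map_id)
  have "chain_boundary (Suc p) (subdivision_homotopy p (frag_of f))
        = chain_map p f (chain_boundary (Suc p) (subd p ?\<iota>))"
    unfolding subdivision_homotopy_def natural_operation_of
    using chain_boundary_chain_map [OF simplicial_imp_singular_chain
        [OF chain_homotopic_simplicial_subdivision2 [OF simplicial_chain_identity_simplex]]]
    by simp
  also have "\<dots> = chain_map p f (simplicial_subdivision p ?\<iota>) - frag_of f
                  - chain_map p f (subd (p - Suc 0) (chain_boundary p ?\<iota>))"
    by (simp add: chain_homotopic_simplicial_subdivision3 [OF simplicial_chain_identity_simplex]
        chain_map_diff f)
  also have "chain_map p f (simplicial_subdivision p ?\<iota>) = singular_subdivision p (frag_of f)"
    by (simp add: singular_subdivision_def)
  also have "chain_map p f (subd (p - Suc 0) (chain_boundary p ?\<iota>)) =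
             subdivision_homotopy (p - Suc 0) (chain_boundary p (frag_of f))"
  proof (cases "p = 0")
    case True
    then show ?thesis
      by (simp add: chain_boundary_def subdivision_homotopy_def)
  next
    case False
    have "simplicial_chain (p - Suc 0) (standard_simplex p) (chain_boundary p ?\<iota>)"
      using simplicial_chain_boundary [OF simplicial_chain_identity_simplex] by simp
    from subdivision_homotopy_chain_map [OF this, of f] False
    have "chain_map p f (subd (p - Suc 0) (chain_boundary p ?\<iota>)) =
          subdivision_homotopy (p - Suc 0) (chain_map (p - Suc 0) f (chain_boundary p ?\<iota>))"
      by simp
    also have "chain_map (p - Suc 0) f (chain_boundary p ?\<iota>) = chain_boundary p (frag_of f)"
      by (metis chain_boundary_chain_map chain_map_of f singular_chain_identity_simplex)
    finally show ?thesis .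
  qed
  finally show ?case
    by (simp add: algebra_simps)
next
  case (diff a b)
  have "chain_boundary (Suc p) (subdivision_homotopy p (a - b)) +
        subdivision_homotopy (p - Suc 0) (chain_boundary p (a - b))
      = (chain_boundary (Suc p) (subdivision_homotopy p a) +
         subdivision_homotopy (p - Suc 0) (chain_boundary p a)) -
        (chain_boundary (Suc p) (subdivision_homotopy p b) +
         subdivision_homotopy (p - Suc 0) (chain_boundary p b))"
    by (simp add: chain_boundary_diff subdivision_homotopy_def natural_operation_diff)
  then show ?case
    by (simp add: diff singular_subdivision_diff)
qed (simp add: subdivision_homotopy_def)

lemma singular_chain_subdivision_power:
  "singular_chain p T z \<Longrightarrow> singular_chain p T ((singular_subdivision p ^^ n) z)"
  by (induction n) (auto simp: singular_chain_singular_subdivision)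

lemma chain_boundary_subdivision_power:
  assumes "singular_chain p T z"
  shows "chain_boundary p ((singular_subdivision p ^^ n) z) =
         (singular_subdivision (p - Suc 0) ^^ n) (chain_boundary p z)"
  by (induction n)
    (auto simp: chain_boundary_singular_subdivision [OF singular_chain_subdivision_power [OF assms]])

text \<open>
  On a cycle, \<open>sd\<^sup>i\<^sup>+\<^sup>1 z - sd\<^sup>i z\<close> is the boundary of the homotopy applied to \<open>sd\<^sup>i z\<close>; the sum over \<open>i < n\<close>
  telescopes. Unlike a choice made for each cycle, this expression is additive and defined for all
  chains, so it can be applied separately to the summands of a cycle \<open>a + b\<close>.
\<close>

definition iterated_homotopy :: "nat \<Rightarrow> nat \<Rightarrow> 'a chain \<Rightarrow> 'a chain" where
  "iterated_homotopy n p z = (\<Sum>i<n. subdivision_homotopy p ((singular_subdivision p ^^ i) z))"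

lemma closure_chain_iterated_homotopy:
  "closure_chain p X c z \<Longrightarrow> closure_chain (Suc p) X c (iterated_homotopy n p z)"
  unfolding iterated_homotopy_def
  by (intro closure_chain_sum closure_chain_subdivision_homotopy closure_chain_subdivision)

lemma subdivision_power_add:
  "(singular_subdivision p ^^ n) (z + w) =
   (singular_subdivision p ^^ n) z + (singular_subdivision p ^^ n) w"
  by (induction n) (auto simp: singular_subdivision_add)

lemma iterated_homotopy_add:
  "iterated_homotopy n p (z + w) = iterated_homotopy n p z + iterated_homotopy n p w"
  by (simp add: iterated_homotopy_def subdivision_homotopy_def subdivision_power_add
      natural_operation_add sum.distrib)

lemma chain_boundary_iterated_homotopy:
  assumes z: "singular_chain p T z" and "chain_boundary p z = 0"
  shows "chain_boundary (Suc p) (iterated_homotopy n p z) = (singular_subdivision p ^^ n) z - z"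
proof (induction n)
  case 0
  then show ?case
    by (simp add: iterated_homotopy_def)
next
  case (Suc n)
  have "chain_boundary p ((singular_subdivision p ^^ n) z) = 0"
    using chain_boundary_subdivision_power [OF z] assms(2) by simp
  then have "chain_boundary (Suc p) (subdivision_homotopy p ((singular_subdivision p ^^ n) z))
             = (singular_subdivision p ^^ Suc n) z - (singular_subdivision p ^^ n) z"
    using chain_homotopy_subdivision [OF singular_chain_subdivision_power [OF z], of n]
    by (simp add: subdivision_homotopy_def)
  moreover have "iterated_homotopy (Suc n) p z = iterated_homotopy n p z +
        subdivision_homotopy p ((singular_subdivision p ^^ n) z)"
    by (simp add: iterated_homotopy_def)
  ultimately show ?case
    using Suc by (simp add: chain_boundary_add)
qed

section \<open>Smallness with respect to an interior cover\<close>

lemma closure_space_mono: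
  assumes "closure_space X c" "S \<subseteq> T" "T \<subseteq> X"
  shows "c S \<subseteq> c T"
proof -
  have "c (S \<union> T) = c S \<union> c T"
    using assms unfolding closure_space_def by auto
  with \<open>S \<subseteq> T\<close> show ?thesis
    by (auto simp: sup.absorb2)
qed

text \<open>
  With \<open>S\<close> the preimage of the complement of \<open>U\<close>, continuity sends the closure of \<open>S\<close> into \<open>c (X - U)\<close>,
  which \<open>f x\<close> avoids. So \<open>x\<close> is not in the closure of \<open>S\<close>.
\<close>

lemma interior_of_preimage:
  assumes X: "closure_space X c" and f: "closure_simplex p X c f" and x: "x \<in> standard_simplex p"
    and fx: "f x \<in> interior_op X c U"
  shows "x \<in> simplex_space p interior_of {y \<in> standard_simplex p. f y \<in> U}"
proof -
  let ?S = "{y \<in> standard_simplex p. f y \<notin> U}"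
  have "f ` (simplex_space p closure_of ?S) \<subseteq> c (f ` ?S)"
    by (rule closure_simplex_image_closure [OF f]) blast
  also have "\<dots> \<subseteq> c (X - U)"
    using closure_simplex_in_space [OF f] by (intro closure_space_mono [OF X]) auto
  finally have "x \<notin> simplex_space p closure_of ?S"
    using fx unfolding interior_op_def by blast
  moreover have "standard_simplex p - {y \<in> standard_simplex p. f y \<in> U} = ?S"
    by blast
  ultimately show ?thesis
    using x by (simp add: interior_of_closure_of)
qed

text \<open>
  Transfers the smallness of fine subdivisions from the standard simplex, a topological space, to
  simplices of a closure space.
\<close>

lemma subdivision_power_of:
  assumes "singular_simplex p T f"
  shows "(singular_subdivision p ^^ n) (frag_of f) =
         chain_map p f ((singular_subdivision p ^^ n) (identity_simplex p))"
proof (induction n)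
  case 0
  then show ?case
    unfolding funpow_0 by (rule singular_simplex_chain_map_id [OF assms, symmetric])
next
  case (Suc n)
  show ?case
    unfolding funpow.simps o_apply Suc.IH
    by (rule naturality_singular_subdivision
        [OF singular_chain_subdivision_power [OF singular_chain_identity_simplex]])
qed

text \<open>
  For one simplex \<open>f\<close>, the interiors of the preimages of the members of the cover form an open cover of the
  standard simplex, a compact topological space, and fine subdivisions of the identity simplex are
  small with respect to it. The bound is required for all \<open>m \<ge> n\<close> so that it passes to differences
  of chains.
\<close>

lemma interior_cover_subdivision_small:
  assumes X: "closure_space X c" and \<U>: "interior_cover X c \<U>" and z: "closure_chain p X c z"
  shows "\<exists>n. \<forall>m\<ge>n. \<forall>g \<in> Poly_Mapping.keys ((singular_subdivision p ^^ m) z).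
               \<exists>U\<in>\<U>. g ` standard_simplex p \<subseteq> U"
  using z unfolding closure_chain_def
proof (induction z rule: frag_induction)
  case (one f)
  then have f: "closure_simplex p X c f"
    by simp
  let ?\<C> = "(\<lambda>U. simplex_space p interior_of {y \<in> standard_simplex p. f y \<in> U}) ` \<U>"
  have "standard_simplex p \<subseteq> \<Union>?\<C>"
  proof
    fix x assume x: "x \<in> standard_simplex p"
    then have "f x \<in> X"
      using closure_simplex_in_space [OF f] by blast
    then obtain U where "U \<in> \<U>" "f x \<in> interior_op X c U"
      using \<U> unfolding interior_cover_def by blast
    then show "x \<in> \<Union>?\<C>"
      using interior_of_preimage [OF X f x] by blast
  qed
  then have cov: "topspace (simplex_space p) \<subseteq> \<Union>?\<C>"
    by simp
  obtain n where n: "\<And>m g. \<lbrakk>n \<le> m;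
        g \<in> Poly_Mapping.keys ((singular_subdivision p ^^ m) (identity_simplex p))\<rbrakk>
        \<Longrightarrow> \<exists>V \<in> ?\<C>. g \<in> standard_simplex p \<rightarrow> V"
    by (rule sufficient_iterated_singular_subdivision_exists
        [OF _ cov singular_chain_identity_simplex]) auto
  have "\<exists>U\<in>\<U>. g ` standard_simplex p \<subseteq> U"
    if m: "n \<le> m" and g: "g \<in> Poly_Mapping.keys ((singular_subdivision p ^^ m) (frag_of f))" for m g
  proof -
    have "singular_simplex p indiscrete_topology f"
      using closure_chain_imp_singular_chain [of p X c "frag_of f"] f
      by (simp add: singular_chain_of)
    then have "g \<in> Poly_Mapping.keys
        (chain_map p f ((singular_subdivision p ^^ m) (identity_simplex p)))"
      using g by (simp add: subdivision_power_of)
    then obtain h where h: "h \<in> Poly_Mapping.keys ((singular_subdivision p ^^ m) (identity_simplex p))"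
      and gh: "g = simplex_map p f h"
      unfolding chain_map_def using subsetD [OF keys_frag_extend] by fastforce
    obtain U where U: "U \<in> \<U>"
      and hU: "h \<in> standard_simplex p \<rightarrow> simplex_space p interior_of {y \<in> standard_simplex p. f y \<in> U}"
      using n [OF m h] by blast
    have "f (h x) \<in> U" if "x \<in> standard_simplex p" for x
      using hU that interior_of_subset [of "simplex_space p" "{y \<in> standard_simplex p. f y \<in> U}"]
      by blast
    then have "g ` standard_simplex p \<subseteq> U"
      by (auto simp: gh simplex_map_def)
    with U show ?thesis ..
  qed
  then show ?case
    by blast
next
  case (diff a b)
  let ?small = "\<lambda>z m. \<forall>g \<in> Poly_Mapping.keys ((singular_subdivision p ^^ m) z).
                        \<exists>U\<in>\<U>. g ` standard_simplex p \<subseteq> U"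
  obtain na nb where na: "\<And>m. na \<le> m \<Longrightarrow> ?small a m" and nb: "\<And>m. nb \<le> m \<Longrightarrow> ?small b m"
    using diff by blast
  have "?small (a - b) m" if "max na nb \<le> m" for m
  proof -
    have "?small a m" "?small b m"
      using that na [of m] nb [of m] by auto
    then show ?thesis
      using keys_diff [of "(singular_subdivision p ^^ m) a" "(singular_subdivision p ^^ m) b"]
      unfolding singular_subdivision_power_diff by blast
  qed
  then show ?case
    by blast
qed auto

locale interior_pair =
  fixes X A B :: "'a set" and c :: "'a set \<Rightarrow> 'a set"
  assumes space: "closure_space X c" and cover: "interior_cover X c {A, B}"
begin

lemma A_subset: "A \<subseteq> X" and B_subset: "B \<subseteq> X"
  using cover by (auto simp: interior_cover_def)

lemma subdivision_split:
  assumes z: "closure_chain p X c z"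
  obtains n a b where "closure_chain p A (subspace_closure A c) a"
    and "closure_chain p B (subspace_closure B c) b"
    and "(singular_subdivision p ^^ n) z = a + b"
proof -
  obtain n where n: "\<And>g. g \<in> Poly_Mapping.keys ((singular_subdivision p ^^ n) z) \<Longrightarrow>
      \<exists>U\<in>{A, B}. g ` standard_simplex p \<subseteq> U"
    using interior_cover_subdivision_small [OF space cover z] by (meson order_refl)
  have "closure_chain p X c ((singular_subdivision p ^^ n) z)"
    using z by (rule closure_chain_subdivision)
  then have "Poly_Mapping.keys ((singular_subdivision p ^^ n) z) \<subseteq>
      Collect (closure_simplex p A (subspace_closure A c)) \<union>
      Collect (closure_simplex p B (subspace_closure B c))"
    using n closure_simplex_subspace_iff [OF A_subset] closure_simplex_subspace_iff [OF B_subset]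
    unfolding closure_chain_def by fastforce
  then show thesis
    using that unfolding closure_chain_def by (metis frag_split)
qed

lemma closure_chain_subspaceD:
  "closure_chain p A (subspace_closure A c) z \<Longrightarrow> closure_chain p X c z"
  "closure_chain p B (subspace_closure B c) z \<Longrightarrow> closure_chain p X c z"
  using closure_chain_subspace_iff A_subset B_subset by blast+

text \<open>
  A sufficiently fine subdivision of the cycle is a sum \<open>a + b\<close>, and the iterated homotopy shows that
  subdividing a cycle does not change its class.
\<close>

lemma cycle_homologous_to_sum:
  assumes z: "closure_chain p X c z" and "chain_boundary p z = 0"
  obtains a b v where "closure_chain p A (subspace_closure A c) a"
    and "closure_chain p B (subspace_closure B c) b"
    and "closure_chain (Suc p) X c v" and "chain_boundary (Suc p) v = a + b - z"
proof -
  obtain n a b where a: "closure_chain p A (subspace_closure A c) a"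
    and b: "closure_chain p B (subspace_closure B c) b"
    and ab: "(singular_subdivision p ^^ n) z = a + b"
    using subdivision_split [OF z] .
  show thesis
    using chain_boundary_iterated_homotopy [OF closure_chain_imp_singular_chain [OF z] assms(2), of n]
    unfolding ab by (rule that [OF a b closure_chain_iterated_homotopy [OF z]])
qed

text \<open>
  If \<open>u\<close> has boundary \<open>a + b\<close>, then \<open>sd\<^sup>n u\<close> splits as \<open>s + t\<close> for some \<open>n\<close> and has boundary \<open>sd\<^sup>n (a + b)\<close>. The
  homotopy corrects this to \<open>a + b\<close>. The chains \<open>a\<close> and \<open>b\<close> need not be cycles, only their sum is one;
  but the correcting chain is additive, so it splits into a chain of \<open>A\<close> and one of \<open>B\<close>.
\<close>

lemma boundary_of_sum:
  assumes u: "closure_chain (Suc p) X c u" and ab: "chain_boundary (Suc p) u = a + b"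
    and a: "closure_chain p A (subspace_closure A c) a"
    and b: "closure_chain p B (subspace_closure B c) b"
  obtains s t where "closure_chain (Suc p) A (subspace_closure A c) s"
    and "closure_chain (Suc p) B (subspace_closure B c) t"
    and "chain_boundary (Suc p) (s + t) = a + b"
proof -
  let ?sd = "\<lambda>n p. singular_subdivision p ^^ n"
  obtain n s t where s: "closure_chain (Suc p) A (subspace_closure A c) s"
    and t: "closure_chain (Suc p) B (subspace_closure B c) t"
    and st: "?sd n (Suc p) u = s + t"
    using subdivision_split [OF u] .
  have su: "singular_chain (Suc p) indiscrete_topology u"
    using u by (rule closure_chain_imp_singular_chain)
  then have "chain_boundary p (a + b) = 0" "singular_chain p indiscrete_topology (a + b)"
    using chain_boundary_boundary_alt singular_chain_boundary_alt unfolding ab [symmetric] by blast+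
  then have "chain_boundary (Suc p) (iterated_homotopy n p (a + b)) = ?sd n p (a + b) - (a + b)"
    by (intro chain_boundary_iterated_homotopy)
  moreover have "chain_boundary (Suc p) (s + t) = ?sd n p (a + b)"
    using chain_boundary_subdivision_power [OF su, of n] unfolding st ab by simp
  ultimately have eq: "chain_boundary (Suc p)
      ((s - iterated_homotopy n p a) + (t - iterated_homotopy n p b)) = a + b"
    by (simp add: chain_boundary_add chain_boundary_diff iterated_homotopy_add)
      (simp add: algebra_simps)
  show thesis
    by (rule that [OF _ _ eq])
      (rule closure_chain_diff s t closure_chain_iterated_homotopy a b)+
qed

end

section \<open>Homology classes\<close>

abbreviation chains :: "int \<Rightarrow> 'a set \<Rightarrow> ('a set \<Rightarrow> 'a set) \<Rightarrow> 'a chain set" where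
  "chains n Y d \<equiv> carrier (closure_chain_group n Y d)"

lemma mem_chains_iff:
  "z \<in> chains n Y d \<longleftrightarrow> (if 0 \<le> n then closure_chain (nat n) Y d z else z = 0)"
  unfolding closure_chain_group_def closure_chain_def by auto

lemma chains_closed:
  "0 \<in> chains n Y d"
  "z \<in> chains n Y d \<Longrightarrow> w \<in> chains n Y d \<Longrightarrow> z + w \<in> chains n Y d"
  "z \<in> chains n Y d \<Longrightarrow> w \<in> chains n Y d \<Longrightarrow> z - w \<in> chains n Y d"
  "z \<in> chains n Y d \<Longrightarrow> - z \<in> chains n Y d"
  by (auto simp: mem_chains_iff closure_chain_add closure_chain_diff split: if_splits)

lemma chain_map_id_chains: "z \<in> chains n Y d \<Longrightarrow> chain_map (nat n) id z = z"
  by (auto simp: mem_chains_iff split: if_splits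
      intro: chain_map_ident closure_chain_imp_singular_chain)

lemma chain_boundary_in_chains:
  assumes "z \<in> chains n Y d"
  shows "chain_boundary (nat n) z \<in> chains (n - 1) Y d"
proof (cases "1 \<le> n")
  case True
  then have "nat (n - 1) = nat n - Suc 0"
    by simp
  with True assms show ?thesis
    by (simp add: mem_chains_iff closure_chain_boundary)
next
  case False
  then show ?thesis
    by (simp add: chain_boundary_def chains_closed)
qed

lemma chain_boundary_boundary_chains:
  assumes "z \<in> chains (n + 1) Y d"
  shows "chain_boundary (nat n) (chain_boundary (nat (n + 1)) z) = 0"
proof (cases "0 \<le> n")
  case True
  then have "nat (n + 1) = Suc (nat n)"
    by simp
  with True assms show ?thesis
    using chain_boundary_boundary_alt [OF closure_chain_imp_singular_chain]
    by (simp add: mem_chains_iff)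
next
  case False
  then show ?thesis
    by (simp add: chain_boundary_def)
qed

definition cycles :: "int \<Rightarrow> 'a set \<Rightarrow> ('a set \<Rightarrow> 'a set) \<Rightarrow> 'a chain set" where
  "cycles n Y d = {z \<in> chains n Y d. chain_boundary (nat n) z = 0}"

lemma cycles_closed:
  "0 \<in> cycles n Y d"
  "z \<in> cycles n Y d \<Longrightarrow> w \<in> cycles n Y d \<Longrightarrow> z + w \<in> cycles n Y d"
  "z \<in> cycles n Y d \<Longrightarrow> w \<in> cycles n Y d \<Longrightarrow> z - w \<in> cycles n Y d"
  "z \<in> cycles n Y d \<Longrightarrow> - z \<in> cycles n Y d"
  by (auto simp: cycles_def chains_closed chain_boundary_add chain_boundary_diff chain_boundary_minus)

lemma boundaries_closed:
  "0 \<in> closure_boundaries n Y d"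
  "z \<in> closure_boundaries n Y d \<Longrightarrow> w \<in> closure_boundaries n Y d \<Longrightarrow> z + w \<in> closure_boundaries n Y d"
  "z \<in> closure_boundaries n Y d \<Longrightarrow> w \<in> closure_boundaries n Y d \<Longrightarrow> z - w \<in> closure_boundaries n Y d"
  "z \<in> closure_boundaries n Y d \<Longrightarrow> - z \<in> closure_boundaries n Y d"
  unfolding closure_boundaries_def
  by (force intro: chains_closed simp flip: chain_boundary_add chain_boundary_diff chain_boundary_minus
      intro: rev_image_eqI [where x = 0])+

lemma boundaries_subset_cycles: "closure_boundaries n Y d \<subseteq> cycles n Y d"
  unfolding closure_boundaries_def cycles_def
  using chain_boundary_in_chains [of _ "n + 1"] chain_boundary_boundary_chains by auto

lemma group_closure_chain_group: "group (closure_chain_group n Y d)"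
  by (simp add: closure_chain_group_def)

lemma subgroup_chain_groupI:
  assumes "S \<subseteq> chains n Y d" "0 \<in> S" "\<And>z w. z \<in> S \<Longrightarrow> w \<in> S \<Longrightarrow> z + w \<in> S"
    "\<And>z. z \<in> S \<Longrightarrow> - z \<in> S"
  shows "subgroup S (closure_chain_group n Y d)"
proof
  fix z assume "z \<in> S"
  with assms(1) have "z \<in> chains n Y d"
    by blast
  then have "inv\<^bsub>closure_chain_group n Y d\<^esub> z = - z"
    unfolding closure_chain_group_def by (simp add: inv_free_Abelian_group)
  with assms(4) \<open>z \<in> S\<close> show "inv\<^bsub>closure_chain_group n Y d\<^esub> z \<in> S"
    by simp
qed (use assms in \<open>auto simp: closure_chain_group_def\<close>)

lemma closure_cycle_group_eq:
  "closure_cycle_group n Y d = subgroup_generated (closure_chain_group n Y d) (cycles n Y d)"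
  unfolding closure_cycle_group_def cycles_def kernel_def by (simp add: closure_chain_group_def)

lemma subgroup_cycles: "subgroup (cycles n Y d) (closure_chain_group n Y d)"
  by (rule subgroup_chain_groupI) (auto simp: cycles_closed, simp add: cycles_def)

lemma carrier_closure_cycle_group [simp]: "carrier (closure_cycle_group n Y d) = cycles n Y d"
  unfolding closure_cycle_group_eq
  by (rule subgroup.carrier_subgroup_generated_subgroup [OF subgroup_cycles])

lemma closure_cycle_group_ops [simp]:
  "z \<otimes>\<^bsub>closure_cycle_group n Y d\<^esub> w = z + w"
  "\<one>\<^bsub>closure_cycle_group n Y d\<^esub> = 0"
  by (simp_all add: closure_cycle_group_def closure_chain_group_def)

lemma comm_group_closure_cycle_group: "comm_group (closure_cycle_group n Y d)"
  unfolding closure_cycle_group_eq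
  by (rule group.abelian_subgroup_generated [OF group_closure_chain_group])
    (simp add: closure_chain_group_def abelian_free_Abelian_group comm_group.axioms)

lemma normal_boundaries: "closure_boundaries n Y d \<lhd> closure_cycle_group n Y d"
proof -
  have "subgroup (closure_boundaries n Y d) (closure_chain_group n Y d)"
    using boundaries_subset_cycles [of n Y d]
    by (intro subgroup_chain_groupI) (auto simp: boundaries_closed cycles_def)
  then have "subgroup (closure_boundaries n Y d) (closure_cycle_group n Y d)"
    unfolding closure_cycle_group_eq
    by (intro group.subgroup_of_subgroup_generated group_closure_chain_group boundaries_subset_cycles)
  then show ?thesis
    by (simp add: comm_group.normal_iff_subgroup comm_group_closure_cycle_group)
qed

abbreviation homology_class ::
  "int \<Rightarrow> 'a set \<Rightarrow> ('a set \<Rightarrow> 'a set) \<Rightarrow> 'a chain \<Rightarrow> 'a chain set" where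
  "homology_class n Y d z \<equiv> closure_boundaries n Y d #>\<^bsub>closure_cycle_group n Y d\<^esub> z"

lemma mem_homology_class_iff:
  "w \<in> homology_class n Y d z \<longleftrightarrow> w - z \<in> closure_boundaries n Y d"
  unfolding r_coset_def by (auto simp: algebra_simps) (metis diff_add_cancel)

lemma homology_class_eq_iff:
  "homology_class n Y d z = homology_class n Y d w \<longleftrightarrow> z - w \<in> closure_boundaries n Y d"
proof
  assume "homology_class n Y d z = homology_class n Y d w"
  then have "z \<in> homology_class n Y d w"
    using mem_homology_class_iff [of z n Y d z] by (simp add: boundaries_closed)
  then show "z - w \<in> closure_boundaries n Y d"
    by (simp add: mem_homology_class_iff)
next
  assume zw: "z - w \<in> closure_boundaries n Y d"
  have "v - z \<in> closure_boundaries n Y d \<longleftrightarrow> v - w \<in> closure_boundaries n Y d" for v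
    using boundaries_closed(2) [OF _ zw, of "v - z"] boundaries_closed(3) [OF _ zw, of "v - w"]
    by auto
  then show "homology_class n Y d z = homology_class n Y d w"
    by (auto simp: mem_homology_class_iff set_eq_iff)
qed

lemma group_closure_homology [simp]: "group (closure_homology n Y d)"
  unfolding closure_homology_def by (rule normal.factorgroup_is_group [OF normal_boundaries])

lemma group_hom_homology_class:
  "group_hom (closure_cycle_group n Y d) (closure_homology n Y d) (homology_class n Y d)"
proof -
  have "homology_class n Y d \<in> hom (closure_cycle_group n Y d) (closure_homology n Y d)"
    unfolding closure_homology_def by (rule normal.r_coset_hom_Mod [OF normal_boundaries])
  then show ?thesis
    by (simp add: group_hom_def group_hom_axioms_def comm_group.axioms comm_group_closure_cycle_group)
qed

lemma carrier_closure_homology: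
  "carrier (closure_homology n Y d) = homology_class n Y d ` cycles n Y d"
  unfolding closure_homology_def FactGroup_def RCOSETS_def by auto

lemma homology_class_in_carrier:
  "z \<in> cycles n Y d \<Longrightarrow> homology_class n Y d z \<in> carrier (closure_homology n Y d)"
  by (simp add: carrier_closure_homology)

lemma mult_homology_class:
  "z \<in> cycles n Y d \<Longrightarrow> w \<in> cycles n Y d \<Longrightarrow>
   homology_class n Y d z \<otimes>\<^bsub>closure_homology n Y d\<^esub> homology_class n Y d w =
   homology_class n Y d (z + w)"
  using group_hom.hom_mult [OF group_hom_homology_class, of z n Y d w] by simp

lemma one_closure_homology: "\<one>\<^bsub>closure_homology n Y d\<^esub> = homology_class n Y d 0"
  using group_hom.hom_one [OF group_hom_homology_class, of n Y d] by simp

lemma homology_class_eq_one_iff: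
  "homology_class n Y d z = \<one>\<^bsub>closure_homology n Y d\<^esub> \<longleftrightarrow> z \<in> closure_boundaries n Y d"
  by (simp add: one_closure_homology homology_class_eq_iff)

lemma inv_homology_class:
  assumes "z \<in> cycles n Y d"
  shows "inv\<^bsub>closure_homology n Y d\<^esub> homology_class n Y d z = homology_class n Y d (- z)"
  by (rule group.inv_equality)
    (use assms in \<open>auto simp: mult_homology_class homology_class_in_carrier cycles_closed
      one_closure_homology\<close>)

text \<open>
  The chain map of an inclusion leaves chains unchanged, so all members of a class yield the same coset
  of the larger group of boundaries.
\<close>

lemma closure_hom_induced_inclusion:
  assumes sub: "\<And>n. chains n Y d \<subseteq> chains n Z e" and z: "z \<in> cycles n Y d"
  shows "closure_hom_induced n Z e id (homology_class n Y d z) = homology_class n Z e z"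
proof -
  have "homology_class n Z e (chain_map (nat n) id w) = homology_class n Z e z"
    if "w \<in> homology_class n Y d z" for w
  proof -
    have wz: "w - z \<in> closure_boundaries n Y d"
      using that by (simp add: mem_homology_class_iff)
    then have "(w - z) + z \<in> cycles n Y d"
      using z boundaries_subset_cycles by (blast intro: cycles_closed)
    then have "w \<in> chains n Y d"
      by (simp add: cycles_def)
    moreover have "w - z \<in> closure_boundaries n Z e"
      using wz sub unfolding closure_boundaries_def by blast
    ultimately show ?thesis
      by (simp add: chain_map_id_chains homology_class_eq_iff)
  qed
  moreover have "z \<in> homology_class n Y d z"
    by (simp add: mem_homology_class_iff boundaries_closed)
  ultimately have "(\<lambda>w. homology_class n Z e (chain_map (nat n) id w)) ` homology_class n Y d z
                   = {homology_class n Z e z}"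
    by blast
  then show ?thesis
    unfolding closure_hom_induced_def by simp
qed

section \<open>The Mayer--Vietoris sequence\<close>

context interior_pair
begin

abbreviation "\<A> \<equiv> subspace_closure A c"
abbreviation "\<B> \<equiv> subspace_closure B c"
abbreviation "\<I> \<equiv> subspace_closure (A \<inter> B) c"

lemma chains_Int: "chains n (A \<inter> B) \<I> = chains n A \<A> \<inter> chains n B \<B>"
proof -
  have "A \<inter> B \<subseteq> X"
    using A_subset by blast
  then show ?thesis
    using closure_chain_subspace_iff [OF A_subset] closure_chain_subspace_iff [OF B_subset]
      closure_chain_subspace_iff [of "A \<inter> B" X]
    by (auto simp: mem_chains_iff image_subset_iff)
qed

lemma chains_subset: "chains n A \<A> \<subseteq> chains n X c" "chains n B \<B> \<subseteq> chains n X c"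
  by (auto simp: mem_chains_iff dest: closure_chain_subspaceD split: if_splits)

lemma mv_diff_homology_class:
  assumes "z \<in> cycles n (A \<inter> B) \<I>"
  shows "mv_diff n A B c (homology_class n (A \<inter> B) \<I> z) =
         (homology_class n A \<A> z, homology_class n B \<B> (- z))"
proof -
  have "z \<in> cycles n B \<B>"
    using assms by (simp add: cycles_def chains_Int)
  then show ?thesis
    using assms by (simp add: mv_diff_def closure_hom_induced_inclusion chains_Int inv_homology_class)
qed

lemma mv_sum_homology_class:
  assumes "a \<in> cycles n A \<A>" "b \<in> cycles n B \<B>"
  shows "mv_sum n X c (homology_class n A \<A> a, homology_class n B \<B> b) = homology_class n X c (a + b)"
proof -
  have "a \<in> cycles n X c" "b \<in> cycles n X c"
    using assms chains_subset by (auto simp: cycles_def)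
  then show ?thesis
    using assms chains_subset
    by (simp add: mv_sum_def closure_hom_induced_inclusion mult_homology_class)
qed

text \<open>
  The form that \<open>cycle_homologous_to_sum\<close> takes in integer degrees; in negative degrees all chains
  vanish.
\<close>

lemma homology_class_decomposition:
  assumes z: "z \<in> cycles n X c"
  obtains a b where "a \<in> chains n A \<A>" "b \<in> chains n B \<B>" "a + b \<in> homology_class n X c z"
proof (cases "0 \<le> n")
  case True
  then have Suc: "nat (n + 1) = Suc (nat n)"
    by simp
  have "closure_chain (nat n) X c z" "chain_boundary (nat n) z = 0"
    using z True by (auto simp: cycles_def mem_chains_iff)
  then obtain a b v where "closure_chain (nat n) A \<A> a" "closure_chain (nat n) B \<B> b"
    and "closure_chain (Suc (nat n)) X c v" "chain_boundary (Suc (nat n)) v = a + b - z"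
    by (rule cycle_homologous_to_sum)
  moreover from this have "a + b - z \<in> closure_boundaries n X c"
    unfolding closure_boundaries_def using True Suc by (force simp: mem_chains_iff)
  ultimately show ?thesis
    using True that by (simp add: mem_chains_iff mem_homology_class_iff)
next
  case False
  with z have "0 + 0 \<in> homology_class n X c z"
    by (simp add: cycles_def mem_chains_iff mem_homology_class_iff boundaries_closed)
  then show ?thesis
    using that chains_closed(1) by blast
qed

text \<open>
  The core of the diagram chase. If \<open>a + b\<close> is the boundary of \<open>s + t\<close>, then \<open>w = a - \<partial>s = \<partial>t - b\<close> lies
  both in \<open>C(A)\<close> and in \<open>C(B)\<close>, hence in \<open>C(A \<inter> B)\<close>. This gives both that the connecting map is well defined
  and exactness at the direct sum.
\<close>

lemma sum_is_boundary:
  assumes a: "a \<in> chains n A \<A>" and b: "b \<in> chains n B \<B>" and ab: "a + b \<in> closure_boundaries n X c"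
  obtains w s t where "w \<in> chains n (A \<inter> B) \<I>" "s \<in> chains (n + 1) A \<A>" "t \<in> chains (n + 1) B \<B>"
    "a = chain_boundary (nat (n + 1)) s + w" "b = chain_boundary (nat (n + 1)) t - w"
proof -
  obtain s t where s: "s \<in> chains (n + 1) A \<A>" and t: "t \<in> chains (n + 1) B \<B>"
    and st: "chain_boundary (nat (n + 1)) (s + t) = a + b"
  proof (cases "0 \<le> n")
    case True
    then have Suc: "nat (n + 1) = Suc (nat n)"
      by simp
    obtain u where "closure_chain (Suc (nat n)) X c u" "chain_boundary (Suc (nat n)) u = a + b"
      using ab True unfolding closure_boundaries_def Suc by (auto simp: mem_chains_iff Suc)
    then obtain s t where "closure_chain (Suc (nat n)) A \<A> s" "closure_chain (Suc (nat n)) B \<B> t"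
      "chain_boundary (Suc (nat n)) (s + t) = a + b"
      using a b True by (auto simp: mem_chains_iff elim: boundary_of_sum)
    then show ?thesis
      using that True by (simp add: mem_chains_iff Suc)
  next
    case False
    with a b show ?thesis
      using that [of 0 0] by (simp add: mem_chains_iff)
  qed
  \<comment> \<open>The boundary of \<open>s + t\<close> is \<open>a + b\<close>, so \<open>?w\<close> is also \<open>\<partial>t - b\<close>, which puts it into \<open>C(B)\<close>.\<close>
  let ?w = "a - chain_boundary (nat (n + 1)) s"
  have "chain_boundary (nat (n + 1)) s \<in> chains n A \<A>" "chain_boundary (nat (n + 1)) t \<in> chains n B \<B>"
    using chain_boundary_in_chains [OF s] chain_boundary_in_chains [OF t] by simp_all
  moreover have w: "?w = chain_boundary (nat (n + 1)) t - b"
    using st by (simp add: chain_boundary_add algebra_simps)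
  ultimately have "?w \<in> chains n A \<A>" "?w \<in> chains n B \<B>"
    using a b chains_closed(3) by (blast, metis chains_closed(3))
  then have "?w \<in> chains n (A \<inter> B) \<I>"
    by (simp add: chains_Int)
  moreover have "b = chain_boundary (nat (n + 1)) t - ?w"
    by (simp add: w)
  ultimately show thesis
    using s t by (intro that [of ?w s t]) simp_all
qed

text \<open>
  The class of \<open>a + b\<close> is sent to that of \<open>\<partial>a\<close>. The choice ranges over all decompositions of all members of
  the class; \<open>connecting_map_homology_class\<close> shows that the result does not depend on it.
\<close>

definition connecting_map :: "int \<Rightarrow> 'a chain set \<Rightarrow> 'a chain set" where
  "connecting_map n K =
     (SOME L. \<exists>a\<in>chains n A \<A>. \<exists>b\<in>chains n B \<B>.
        a + b \<in> K \<and> L = homology_class (n - 1) (A \<inter> B) \<I> (chain_boundary (nat n) a))"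

text \<open>
  If \<open>a + b\<close> and \<open>a' + b'\<close> are homologous in \<open>X\<close>, then \<open>a' - a\<close> is a boundary plus a chain \<open>w\<close> of \<open>A \<inter> B\<close> by
  \<open>sum_is_boundary\<close>, so \<open>\<partial>a'\<close> and \<open>\<partial>a\<close> differ by the boundary of \<open>w\<close>.
\<close>

lemma connecting_map_homology_class:
  assumes a: "a \<in> chains n A \<A>" and b: "b \<in> chains n B \<B>" and ab: "a + b \<in> homology_class n X c z"
  shows "connecting_map n (homology_class n X c z) =
         homology_class (n - 1) (A \<inter> B) \<I> (chain_boundary (nat n) a)"
  unfolding connecting_map_def
proof (rule some_equality)
  fix L assume "\<exists>a\<in>chains n A \<A>. \<exists>b\<in>chains n B \<B>. a + b \<in> homology_class n X c z \<and>
      L = homology_class (n - 1) (A \<inter> B) \<I> (chain_boundary (nat n) a)"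
  then obtain a' b' where a': "a' \<in> chains n A \<A>" and b': "b' \<in> chains n B \<B>"
    and ab': "a' + b' \<in> homology_class n X c z"
    and L: "L = homology_class (n - 1) (A \<inter> B) \<I> (chain_boundary (nat n) a')"
    by blast
  have "(a' + b' - z) - (a + b - z) \<in> closure_boundaries n X c"
    using ab' ab unfolding mem_homology_class_iff by (rule boundaries_closed(3))
  then have "(a' - a) + (b' - b) \<in> closure_boundaries n X c"
    by (simp add: algebra_simps)
  then obtain w s where w: "w \<in> chains n (A \<inter> B) \<I>" and s: "s \<in> chains (n + 1) A \<A>"
    and eq: "a' - a = chain_boundary (nat (n + 1)) s + w"
    by (rule sum_is_boundary [OF chains_closed(3) [OF a' a] chains_closed(3) [OF b' b]])
  have "chain_boundary (nat n) a' - chain_boundary (nat n) a = chain_boundary (nat n) w"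
    using chain_boundary_boundary_chains [OF s]
    by (simp add: eq chain_boundary_add flip: chain_boundary_diff)
  then have "chain_boundary (nat n) a' - chain_boundary (nat n) a \<in>
      closure_boundaries (n - 1) (A \<inter> B) \<I>"
    using w by (simp add: closure_boundaries_def)
  then show "L = homology_class (n - 1) (A \<inter> B) \<I> (chain_boundary (nat n) a)"
    by (simp add: L homology_class_eq_iff)
qed (use a b ab in blast)

text \<open>
  As \<open>a + b\<close> is a cycle, \<open>\<partial>a = - \<partial>b\<close> lies in \<open>C(A)\<close> and in \<open>C(B)\<close>.
\<close>

lemma boundary_of_decomposition:
  assumes a: "a \<in> chains n A \<A>" and b: "b \<in> chains n B \<B>" and ab: "a + b \<in> cycles n X c"
  shows "chain_boundary (nat n) a \<in> cycles (n - 1) (A \<inter> B) \<I>"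
proof -
  have "chain_boundary (nat n) a = chain_boundary (nat n) (- b)"
    using ab by (simp add: cycles_def chain_boundary_add chain_boundary_minus eq_neg_iff_add_eq_0)
  moreover have "chain_boundary (nat n) (- b) \<in> chains (n - 1) B \<B>"
    using b by (intro chain_boundary_in_chains chains_closed)
  moreover have "chain_boundary (nat n) a \<in> chains (n - 1) A \<A>"
    using a by (rule chain_boundary_in_chains)
  moreover have "chain_boundary (nat (n - 1)) (chain_boundary (nat n) a) = 0"
    using chain_boundary_boundary_chains [of a "n - 1"] a by simp
  ultimately show ?thesis
    by (simp add: cycles_def chains_Int)
qed

text \<open>
  Every class of \<open>X\<close> is presented by a cycle that is already decomposed, on which the connecting map has
  its explicit form.
\<close>

lemma homology_class_cases:
  assumes "K \<in> carrier (closure_homology n X c)"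
  obtains a b where "a \<in> chains n A \<A>" "b \<in> chains n B \<B>" "a + b \<in> cycles n X c"
    "K = homology_class n X c (a + b)"
    "connecting_map n K = homology_class (n - 1) (A \<inter> B) \<I> (chain_boundary (nat n) a)"
proof -
  obtain z where z: "z \<in> cycles n X c" and K: "K = homology_class n X c z"
    using assms by (auto simp: carrier_closure_homology)
  obtain a b where a: "a \<in> chains n A \<A>" and b: "b \<in> chains n B \<B>"
    and ab: "a + b \<in> homology_class n X c z"
    using homology_class_decomposition [OF z] .
  have eq: "homology_class n X c z = homology_class n X c (a + b)"
    using ab boundaries_closed(4) [of "a + b - z" n X c]
    by (simp add: mem_homology_class_iff homology_class_eq_iff)
  have "(a + b - z) + z \<in> cycles n X c"
    using ab by (intro cycles_closed(2) [OF subsetD [OF boundaries_subset_cycles] z])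
      (simp add: mem_homology_class_iff)
  then show thesis
    using that [OF a b] connecting_map_homology_class [OF a b ab] eq K by simp
qed

lemma connecting_map_sum:
  assumes "a \<in> chains n A \<A>" "b \<in> chains n B \<B>"
  shows "connecting_map n (homology_class n X c (a + b)) =
         homology_class (n - 1) (A \<inter> B) \<I> (chain_boundary (nat n) a)"
  using assms by (intro connecting_map_homology_class)
    (auto simp: mem_homology_class_iff boundaries_closed)

lemma carrier_sum_cases:
  assumes "p \<in> carrier (closure_homology n A \<A> \<times>\<times> closure_homology n B \<B>)"
  obtains a b where "a \<in> cycles n A \<A>" "b \<in> cycles n B \<B>"
    "p = (homology_class n A \<A> a, homology_class n B \<B> b)"
  using assms by (auto simp: DirProd_def carrier_closure_homology)

lemma cycles_Int: "cycles n (A \<inter> B) \<I> = cycles n A \<A> \<inter> cycles n B \<B>"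
  by (auto simp: cycles_def chains_Int)

lemma cycles_subset: "cycles n A \<A> \<subseteq> cycles n X c" "cycles n B \<B> \<subseteq> cycles n X c"
  using chains_subset by (auto simp: cycles_def)

lemma group_hom_mv_diff:
  "group_hom (closure_homology n (A \<inter> B) \<I>)
     (closure_homology n A \<A> \<times>\<times> closure_homology n B \<B>) (mv_diff n A B c)"
proof -
  have "mv_diff n A B c \<in> hom (closure_homology n (A \<inter> B) \<I>)
          (closure_homology n A \<A> \<times>\<times> closure_homology n B \<B>)"
    by (rule homI)
      (auto simp: carrier_closure_homology mv_diff_homology_class mult_homology_class
        cycles_Int cycles_closed)
  then show ?thesis
    by (simp add: group_hom_def group_hom_axioms_def DirProd_group)
qed

lemma group_hom_mv_sum:
  "group_hom (closure_homology n A \<A> \<times>\<times> closure_homology n B \<B>) (closure_homology n X c)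
     (mv_sum n X c)"
proof -
  have "mv_sum n X c \<in> hom (closure_homology n A \<A> \<times>\<times> closure_homology n B \<B>)
          (closure_homology n X c)"
  proof (rule homI)
    fix p assume "p \<in> carrier (closure_homology n A \<A> \<times>\<times> closure_homology n B \<B>)"
    then obtain a b where "a \<in> cycles n A \<A>" "b \<in> cycles n B \<B>"
      "p = (homology_class n A \<A> a, homology_class n B \<B> b)"
      by (rule carrier_sum_cases)
    then show "mv_sum n X c p \<in> carrier (closure_homology n X c)"
      using cycles_subset [of n]
      by (auto simp: mv_sum_homology_class intro!: homology_class_in_carrier cycles_closed)
  next
    fix p q assume "p \<in> carrier (closure_homology n A \<A> \<times>\<times> closure_homology n B \<B>)"
      and "q \<in> carrier (closure_homology n A \<A> \<times>\<times> closure_homology n B \<B>)"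
    then obtain a b a' b' where ab: "a \<in> cycles n A \<A>" "b \<in> cycles n B \<B>"
      "p = (homology_class n A \<A> a, homology_class n B \<B> b)"
      and ab': "a' \<in> cycles n A \<A>" "b' \<in> cycles n B \<B>"
      "q = (homology_class n A \<A> a', homology_class n B \<B> b')"
      by (metis carrier_sum_cases)
    moreover have "a + b \<in> cycles n X c" "a' + b' \<in> cycles n X c"
      using ab ab' cycles_subset [of n] by (auto intro: cycles_closed)
    ultimately show "mv_sum n X c (p \<otimes>\<^bsub>closure_homology n A \<A> \<times>\<times> closure_homology n B \<B>\<^esub> q) =
        mv_sum n X c p \<otimes>\<^bsub>closure_homology n X c\<^esub> mv_sum n X c q"
      by (simp add: mult_homology_class mv_sum_homology_class cycles_closed algebra_simps)
  qed
  then show ?thesis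
    by (simp add: group_hom_def group_hom_axioms_def DirProd_group)
qed

lemma group_hom_connecting_map:
  "group_hom (closure_homology n X c) (closure_homology (n - 1) (A \<inter> B) \<I>) (connecting_map n)"
proof -
  have "connecting_map n \<in> hom (closure_homology n X c) (closure_homology (n - 1) (A \<inter> B) \<I>)"
  proof (rule homI)
    fix K assume "K \<in> carrier (closure_homology n X c)"
    then show "connecting_map n K \<in> carrier (closure_homology (n - 1) (A \<inter> B) \<I>)"
      by (rule homology_class_cases) (simp add: homology_class_in_carrier boundary_of_decomposition)
  next
    fix K L assume K: "K \<in> carrier (closure_homology n X c)" and L: "L \<in> carrier (closure_homology n X c)"
    obtain a b where a: "a \<in> chains n A \<A>" "b \<in> chains n B \<B>" "a + b \<in> cycles n X c"
      "K = homology_class n X c (a + b)"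
      "connecting_map n K = homology_class (n - 1) (A \<inter> B) \<I> (chain_boundary (nat n) a)"
      using homology_class_cases [OF K] .
    obtain a' b' where a': "a' \<in> chains n A \<A>" "b' \<in> chains n B \<B>" "a' + b' \<in> cycles n X c"
      "L = homology_class n X c (a' + b')"
      "connecting_map n L = homology_class (n - 1) (A \<inter> B) \<I> (chain_boundary (nat n) a')"
      using homology_class_cases [OF L] .
    have "K \<otimes>\<^bsub>closure_homology n X c\<^esub> L = homology_class n X c ((a + a') + (b + b'))"
      using a a' by (simp add: mult_homology_class algebra_simps)
    then have "connecting_map n (K \<otimes>\<^bsub>closure_homology n X c\<^esub> L) =
        homology_class (n - 1) (A \<inter> B) \<I> (chain_boundary (nat n) (a + a'))"
      using a a' by (simp only: connecting_map_sum chains_closed)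
    also have "\<dots> = connecting_map n K \<otimes>\<^bsub>closure_homology (n - 1) (A \<inter> B) \<I>\<^esub> connecting_map n L"
      using a a' by (simp add: mult_homology_class boundary_of_decomposition chain_boundary_add)
    finally show "connecting_map n (K \<otimes>\<^bsub>closure_homology n X c\<^esub> L) =
        connecting_map n K \<otimes>\<^bsub>closure_homology (n - 1) (A \<inter> B) \<I>\<^esub> connecting_map n L" .
  qed
  then show ?thesis
    by (simp add: group_hom_def group_hom_axioms_def)
qed

text \<open>
  A pair of classes whose sum vanishes comes from the chain \<open>w\<close> of \<open>sum_is_boundary\<close>, which is homologous to
  \<open>a\<close> in \<open>A\<close> and to \<open>- b\<close> in \<open>B\<close>.
\<close>

lemma exact_at_sum:
  "exact_at (closure_homology n (A \<inter> B) \<I>) (mv_diff n A B c)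
     (closure_homology n A \<A> \<times>\<times> closure_homology n B \<B>) (mv_sum n X c) (closure_homology n X c)"
  unfolding exact_at_def
proof (intro conjI group_hom_mv_diff group_hom_mv_sum subset_antisym subsetI)
  fix p assume "p \<in> mv_diff n A B c ` carrier (closure_homology n (A \<inter> B) \<I>)"
  then obtain w where w: "w \<in> cycles n A \<A>" "w \<in> cycles n B \<B>"
    and p: "p = (homology_class n A \<A> w, homology_class n B \<B> (- w))"
    by (auto simp: carrier_closure_homology mv_diff_homology_class cycles_Int)
  show "p \<in> kernel (closure_homology n A \<A> \<times>\<times> closure_homology n B \<B>) (closure_homology n X c)
      (mv_sum n X c)"
    unfolding kernel_def p using w
    by (simp add: mv_sum_homology_class cycles_closed homology_class_in_carrier
        homology_class_eq_one_iff boundaries_closed)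
next
  fix p assume p: "p \<in> kernel (closure_homology n A \<A> \<times>\<times> closure_homology n B \<B>)
      (closure_homology n X c) (mv_sum n X c)"
  then have "p \<in> carrier (closure_homology n A \<A> \<times>\<times> closure_homology n B \<B>)"
    by (simp add: kernel_def)
  then obtain a b where a: "a \<in> cycles n A \<A>" and b: "b \<in> cycles n B \<B>"
    and pab: "p = (homology_class n A \<A> a, homology_class n B \<B> b)"
    by (rule carrier_sum_cases)
  have "a + b \<in> closure_boundaries n X c"
    using p a b by (simp add: kernel_def pab mv_sum_homology_class homology_class_eq_one_iff)
  then obtain w s t where w: "w \<in> chains n (A \<inter> B) \<I>" and s: "s \<in> chains (n + 1) A \<A>"
    and t: "t \<in> chains (n + 1) B \<B>" and as: "a = chain_boundary (nat (n + 1)) s + w"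
    and bt: "b = chain_boundary (nat (n + 1)) t - w"
    using a b sum_is_boundary [of a n b] by (auto simp: cycles_def)
  have "w \<in> cycles n (A \<inter> B) \<I>"
    using w a chain_boundary_boundary_chains [OF s] by (simp add: cycles_def as chain_boundary_add)
  moreover have "a - w \<in> closure_boundaries n A \<A>" "b - (- w) \<in> closure_boundaries n B \<B>"
    using s t by (simp_all add: as bt closure_boundaries_def)
  ultimately show "p \<in> mv_diff n A B c ` carrier (closure_homology n (A \<inter> B) \<I>)"
    by (intro rev_image_eqI [of "homology_class n (A \<inter> B) \<I> w"])
      (simp_all add: homology_class_in_carrier mv_diff_homology_class pab homology_class_eq_iff)
qed

text \<open>
  If \<open>\<partial>a = \<partial>w\<close> with \<open>w\<close> a chain of \<open>A \<inter> B\<close>, then \<open>a + b = (a - w) + (b + w)\<close> is a sum of a cycle of \<open>A\<close> and a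
  cycle of \<open>B\<close>.
\<close>

lemma exact_at_space:
  "exact_at (closure_homology n A \<A> \<times>\<times> closure_homology n B \<B>) (mv_sum n X c)
     (closure_homology n X c) (connecting_map n) (closure_homology (n - 1) (A \<inter> B) \<I>)"
  unfolding exact_at_def
proof (intro conjI group_hom_mv_sum group_hom_connecting_map subset_antisym subsetI)
  fix K assume "K \<in> mv_sum n X c ` carrier (closure_homology n A \<A> \<times>\<times> closure_homology n B \<B>)"
  then obtain p where "p \<in> carrier (closure_homology n A \<A> \<times>\<times> closure_homology n B \<B>)"
    and Kp: "K = mv_sum n X c p"
    by blast
  then obtain a b where a: "a \<in> cycles n A \<A>" and b: "b \<in> cycles n B \<B>"
    and p: "p = (homology_class n A \<A> a, homology_class n B \<B> b)"
    using carrier_sum_cases by blast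
  then have K: "K = homology_class n X c (a + b)"
    by (simp add: Kp mv_sum_homology_class)
  have "a + b \<in> cycles n X c"
    using a b cycles_subset [of n] by (auto intro: cycles_closed)
  moreover have "connecting_map n K = homology_class (n - 1) (A \<inter> B) \<I> 0"
    using a b by (simp add: K connecting_map_sum cycles_def)
  ultimately show "K \<in> kernel (closure_homology n X c) (closure_homology (n - 1) (A \<inter> B) \<I>)
      (connecting_map n)"
    by (simp add: kernel_def K homology_class_in_carrier one_closure_homology)
next
  fix K assume K: "K \<in> kernel (closure_homology n X c) (closure_homology (n - 1) (A \<inter> B) \<I>)
      (connecting_map n)"
  then obtain a b where a: "a \<in> chains n A \<A>" and b: "b \<in> chains n B \<B>"
    and ab: "a + b \<in> cycles n X c" and Kab: "K = homology_class n X c (a + b)"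
    and "connecting_map n K = homology_class (n - 1) (A \<inter> B) \<I> (chain_boundary (nat n) a)"
    unfolding kernel_def by (auto elim: homology_class_cases)
  then have "chain_boundary (nat n) a \<in> closure_boundaries (n - 1) (A \<inter> B) \<I>"
    using K by (simp add: kernel_def homology_class_eq_one_iff)
  then obtain w where w: "w \<in> chains n (A \<inter> B) \<I>"
    and aw: "chain_boundary (nat n) a = chain_boundary (nat n) w"
    by (auto simp: closure_boundaries_def)
  have "a - w \<in> cycles n A \<A>" "b + w \<in> cycles n B \<B>"
    using a b w ab aw
    by (simp_all add: cycles_def chains_Int chains_closed chain_boundary_add chain_boundary_diff)
      (simp add: add.commute)
  then show "K \<in> mv_sum n X c ` carrier (closure_homology n A \<A> \<times>\<times> closure_homology n B \<B>)"
    by (intro rev_image_eqI [of "(homology_class n A \<A> (a - w), homology_class n B \<B> (b + w))"])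
      (simp_all add: homology_class_in_carrier mv_sum_homology_class Kab)
qed

text \<open>
  If \<open>w = \<partial>a\<close> in \<open>A\<close> and \<open>- w = \<partial>b\<close> in \<open>B\<close>, then \<open>a + b\<close> is a cycle of \<open>X\<close>, and the connecting map sends its
  class to that of \<open>w\<close>.
\<close>

lemma exact_at_intersection:
  "exact_at (closure_homology n X c) (connecting_map n) (closure_homology (n - 1) (A \<inter> B) \<I>)
     (mv_diff (n - 1) A B c) (closure_homology (n - 1) A \<A> \<times>\<times> closure_homology (n - 1) B \<B>)"
  unfolding exact_at_def
proof (intro conjI group_hom_mv_diff group_hom_connecting_map subset_antisym subsetI)
  fix L assume "L \<in> connecting_map n ` carrier (closure_homology n X c)"
  then obtain a b where a: "a \<in> chains n A \<A>" and b: "b \<in> chains n B \<B>"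
    and ab: "a + b \<in> cycles n X c"
    and L: "L = homology_class (n - 1) (A \<inter> B) \<I> (chain_boundary (nat n) a)"
    by (auto elim: homology_class_cases)
  have "- chain_boundary (nat n) a = chain_boundary (nat n) b"
    using ab by (simp add: cycles_def chain_boundary_add neg_eq_iff_add_eq_0)
  then have "chain_boundary (nat n) a \<in> closure_boundaries (n - 1) A \<A>"
    "- chain_boundary (nat n) a \<in> closure_boundaries (n - 1) B \<B>"
    using a b by (simp_all add: closure_boundaries_def)
  then show "L \<in> kernel (closure_homology (n - 1) (A \<inter> B) \<I>)
      (closure_homology (n - 1) A \<A> \<times>\<times> closure_homology (n - 1) B \<B>) (mv_diff (n - 1) A B c)"
    using boundary_of_decomposition [OF a b ab]
    by (simp add: kernel_def L homology_class_in_carrier mv_diff_homology_class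
        homology_class_eq_one_iff)
next
  fix L assume L: "L \<in> kernel (closure_homology (n - 1) (A \<inter> B) \<I>)
      (closure_homology (n - 1) A \<A> \<times>\<times> closure_homology (n - 1) B \<B>) (mv_diff (n - 1) A B c)"
  then obtain w where w: "w \<in> cycles (n - 1) (A \<inter> B) \<I>"
    and Lw: "L = homology_class (n - 1) (A \<inter> B) \<I> w"
    unfolding kernel_def by (auto simp: carrier_closure_homology)
  then have "w \<in> closure_boundaries (n - 1) A \<A>" "- w \<in> closure_boundaries (n - 1) B \<B>"
    using L by (simp_all add: kernel_def mv_diff_homology_class homology_class_eq_one_iff)
  then obtain a b where a: "a \<in> chains n A \<A>" and b: "b \<in> chains n B \<B>"
    and wa: "w = chain_boundary (nat n) a" and wb: "- w = chain_boundary (nat n) b"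
    by (auto simp: closure_boundaries_def)
  have "a + b \<in> cycles n X c"
    using chains_closed(2) [OF subsetD [OF chains_subset(1) a] subsetD [OF chains_subset(2) b]]
    by (simp add: cycles_def chain_boundary_add flip: wa wb)
  then show "L \<in> connecting_map n ` carrier (closure_homology n X c)"
    by (intro rev_image_eqI [of "homology_class n X c (a + b)"])
      (simp_all add: homology_class_in_carrier connecting_map_sum a b Lw wa)
qed

end

theorem theorem4p7:
  fixes X A B :: "'a set" and c :: "'a set \<Rightarrow> 'a set"
  assumes "closure_space X c" and "interior_cover X c {A, B}"
  defines "HAB \<equiv> \<lambda>n::int. closure_homology n (A \<inter> B) (subspace_closure (A \<inter> B) c)"
    and "HA_HB \<equiv> \<lambda>n::int. closure_homology n A (subspace_closure A c) \<times>\<times>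
                            closure_homology n B (subspace_closure B c)"
    and "HX \<equiv> \<lambda>n::int. closure_homology n X c"
  shows "\<exists>\<delta> :: int \<Rightarrow> 'a chain set \<Rightarrow> 'a chain set. \<forall>n.
           exact_at (HAB n) (mv_diff n A B c) (HA_HB n) (mv_sum n X c) (HX n) \<and>
           exact_at (HA_HB n) (mv_sum n X c) (HX n) (\<delta> n) (HAB (n - 1)) \<and>
           exact_at (HX n) (\<delta> n) (HAB (n - 1)) (mv_diff (n - 1) A B c) (HA_HB (n - 1))"
proof -
  interpret interior_pair X A B c
    using assms(1,2) by unfold_locales
  show ?thesis
    unfolding HAB_def HA_HB_def HX_def
    using exact_at_sum exact_at_space exact_at_intersection by blast
qed

end
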